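(* Let $F: X\to[-\infty,\infty]$ and $G_*: Y\to[-\infty,\infty]$ be convex, proper, and lower semicontinuous. Also let $K\in C^1(X\times Y)$ be convex-concave within $\operatorname{dom}F\times\operatorname{dom}G_*$. Finally, let $J_X\in C^1(X)$ and $J_Y\in C^1(Y)$ be convex. If $B^0$ is semi-elliptic (on $X\times Y$), then the iterates $\{u^{k+1}\}_{k\in\mathbb{N}}$ generated by the PDBS for any initial $u^0\in X\times Y$, with the ergodic sequence $\tilde u^N:=\frac1N\sum_{k=0}^{N-1}u^{k+1}$, satisfy: (i) $0\le\frac1N\sum_{k=0}^{N-1}\mathcal{G}^{\mathcal{L}}(u^{k+1},\hat u)\to 0$ at the rate $O(1/N)$ for every $\hat u\in H^{-1}(0)$. (ii) $0\le\mathcal{G}^{\mathcal{L}}(\tilde u^N,\hat u)\to 0$ at the rate $O(1/N)$ for every $\hat u\in H^{-1}(0)$. (iii) If $\Omega\subset X\times Y$ is bounded with $\Omega\cap H^{-1}(0)\ne\emptyset$, then $0\le\mathcal{G}_\Omega(\tilde u^N)\to 0$ at the rate $O(1/N)$ for the partial gap $\mathcal{G}_\Omega(u):=\sup_{\bar u\in\Omega}\mathcal{G}^{\mathcal{L}}(u,\bar u)$.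
   Context: All spaces are real; $X,Y$ are Banach spaces, $u=(x,y)\in X\times Y$, $u^k=(x^k,y^k)$, etc. $\langle\cdot|\cdot\rangle$ is the dual pairing, $\partial$ the convex subdifferential, $D$ the Gâteaux derivative, $D_xK,D_yK$ the partial derivatives of $K$. Convex-concave means convex in $x$ for each fixed $y$ and concave in $y$ for each fixed $x$. The set-valued map $H: X\times Y\rightrightarrows X^*\times Y^*$ is $H(x,y)=\big(\partial F(x)+D_xK(x,y)\big)\times\big(\partial G_*(y)-D_yK(x,y)\big)$, and $H^{-1}(0)=\{u: 0\in H(u)\}$. For a Gâteaux-differentiable function $J$ the Bregman divergence is $B_J(z,x)=J(z)-J(x)-\langle DJ(x)|z-x\rangle$. Set $J^0(x,y)=J_X(x)+J_Y(y)-K(x,y)$ and $B^0=B_{J^0}$. Semi-elliptic means $B^0(u',u)\ge 0$ for all $u,u'\in X\times Y$. PDBS (primal-dual Bregman-proximal splitting): given $u^0$, for each $k\in\mathbb{N}$ the iterate $u^{k+1}=(x^{k+1},y^{k+1})$ solves $$DJ_X(x^k)-D_xK(x^k,y^k)\in DJ_X(x^{k+1})+\partial F(x^{k+1}),$$ $$DJ_Y(y^k)-D_yK(x^k,y^k)\in DJ_Y(y^{k+1})+\partial G_*(y^{k+1})-2D_yK(x^{k+1},y^{k+1}).$$ With the Lagrangian $\mathcal{L}(x,y)=F(x)+K(x,y)-G_*(y)$, the Lagrangian gap is $\mathcal{G}^{\mathcal{L}}(u,\bar u)=\mathcal{L}(x,\bar y)-\mathcal{L}(\bar x,y)$ for $u=(x,y)$,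 $\bar u=(\bar x,\bar y)$. *)

theory Defs
  imports "HOL-Analysis.Analysis" "HOL-Library.Set_Algebras" "HOL-Library.Landau_Symbols"
begin

section \<open>Extended-real-valued convex functions\<close>

definition effective_domain :: "('a \<Rightarrow> ereal) \<Rightarrow> 'a set" where
  "effective_domain f = {x. f x < \<infinity>}"

definition proper_fun :: "('a \<Rightarrow> ereal) \<Rightarrow> bool" where
  "proper_fun f \<longleftrightarrow> (\<forall>x. f x \<noteq> - \<infinity>) \<and> (\<exists>x. f x \<noteq> \<infinity>)"

text \<open>Convexity of the epigraph, which avoids adding infinities of opposite sign.\<close>

definition convex_ereal_fun :: "('a::real_vector \<Rightarrow> ereal) \<Rightarrow> bool" where
  "convex_ereal_fun f \<longleftrightarrow> convex {(x, t::real). f x \<le> ereal t}"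

definition lower_semicontinuous :: "('a::topological_space \<Rightarrow> ereal) \<Rightarrow> bool" where
  "lower_semicontinuous f \<longleftrightarrow> (\<forall>x. f x \<le> Liminf (at x) f)"

text \<open>The dual space of \<open>'a\<close> is \<open>'a \<Rightarrow>\<^sub>L real\<close>. The subdifferential is empty
  wherever \<open>f\<close> is not finite.\<close>

definition subdifferential ::
    "('a::real_normed_vector \<Rightarrow> ereal) \<Rightarrow> 'a \<Rightarrow> ('a \<Rightarrow>\<^sub>L real) set" where
  "subdifferential f x =
     {p. \<bar>f x\<bar> \<noteq> \<infinity> \<and> (\<forall>z. f x + ereal (blinfun_apply p (z - x)) \<le> f z)}"


section \<open>Gateaux derivatives and Bregman divergences\<close>

definition has_gateaux_derivative ::
    "('a::real_normed_vector \<Rightarrow> real) \<Rightarrow> ('a \<Rightarrow>\<^sub>L real) \<Rightarrow> 'a \<Rightarrow> bool" where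
  "has_gateaux_derivative J A x \<longleftrightarrow>
     (\<forall>h. ((\<lambda>t. (J (x + t *\<^sub>R h) - J x) / t) \<longlongrightarrow> blinfun_apply A h) (at 0))"

text \<open>The value is meaningful only at points of differentiability, where it is unique.\<close>

definition gateaux_deriv ::
    "('a::real_normed_vector \<Rightarrow> real) \<Rightarrow> 'a \<Rightarrow> ('a \<Rightarrow>\<^sub>L real)" where
  "gateaux_deriv J x = (THE A. has_gateaux_derivative J A x)"

text \<open>Continuity of the derivative is with respect to the operator norm on the dual space.\<close>

definition C1_fun :: "('a::real_normed_vector \<Rightarrow> real) \<Rightarrow> bool" where
  "C1_fun J \<longleftrightarrow> (\<forall>x. \<exists>A. has_gateaux_derivative J A x) \<and> continuous_on UNIV (gateaux_deriv J)"

definition partial_x ::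
    "('a::real_normed_vector \<times> 'b::real_normed_vector \<Rightarrow> real) \<Rightarrow> 'a \<times> 'b \<Rightarrow> ('a \<Rightarrow>\<^sub>L real)" where
  "partial_x K u = gateaux_deriv (\<lambda>x. K (x, snd u)) (fst u)"

definition partial_y ::
    "('a::real_normed_vector \<times> 'b::real_normed_vector \<Rightarrow> real) \<Rightarrow> 'a \<times> 'b \<Rightarrow> ('b \<Rightarrow>\<^sub>L real)" where
  "partial_y K u = gateaux_deriv (\<lambda>y. K (fst u, y)) (snd u)"

definition bregman :: "('a::real_normed_vector \<Rightarrow> real) \<Rightarrow> 'a \<Rightarrow> 'a \<Rightarrow> real" where
  "bregman J z x = J z - J x - blinfun_apply (gateaux_deriv J x) (z - x)"

definition semi_elliptic :: "('a \<Rightarrow> 'a \<Rightarrow> real) \<Rightarrow> bool" where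
  "semi_elliptic B \<longleftrightarrow> (\<forall>u u'. 0 \<le> B u' u)"


section \<open>The saddle-point problem and the splitting method\<close>

definition convex_concave_within ::
    "('a::real_vector) set \<Rightarrow> ('b::real_vector) set \<Rightarrow> ('a \<times> 'b \<Rightarrow> real) \<Rightarrow> bool" where
  "convex_concave_within A B K \<longleftrightarrow>
     (\<forall>y\<in>B. convex_on A (\<lambda>x. K (x, y))) \<and> (\<forall>x\<in>A. concave_on B (\<lambda>y. K (x, y)))"

text \<open>\<open>G\<close> stands for the function usually written with a lower star; it is not assumed to be
  a conjugate.\<close>

definition saddle_map ::
    "('a::real_normed_vector \<Rightarrow> ereal) \<Rightarrow> ('b::real_normed_vector \<Rightarrow> ereal) \<Rightarrow>
     ('a \<times> 'b \<Rightarrow> real) \<Rightarrow> 'a \<times> 'b \<Rightarrow> (('a \<Rightarrow>\<^sub>L real) \<times> ('b \<Rightarrow>\<^sub>L real)) set" where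
  "saddle_map F G K u =
     (partial_x K u +o subdifferential F (fst u)) \<times>
     ((- partial_y K u) +o subdifferential G (snd u))"

definition saddle_zeros ::
    "('a::real_normed_vector \<Rightarrow> ereal) \<Rightarrow> ('b::real_normed_vector \<Rightarrow> ereal) \<Rightarrow>
     ('a \<times> 'b \<Rightarrow> real) \<Rightarrow> ('a \<times> 'b) set" where
  "saddle_zeros F G K = {u. 0 \<in> saddle_map F G K u}"

definition J0 :: "('a \<Rightarrow> real) \<Rightarrow> ('b \<Rightarrow> real) \<Rightarrow> ('a \<times> 'b \<Rightarrow> real) \<Rightarrow> 'a \<times> 'b \<Rightarrow> real" where
  "J0 JX JY K u = JX (fst u) + JY (snd u) - K u"

text \<open>The inclusions are implicit and need neither have a solution nor a unique one: the
  predicate says that \<open>u\<close> is some sequence of iterates, with initial point \<open>u 0\<close>.\<close>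

definition pdbs ::
    "('a::real_normed_vector \<Rightarrow> ereal) \<Rightarrow> ('b::real_normed_vector \<Rightarrow> ereal) \<Rightarrow>
     ('a \<times> 'b \<Rightarrow> real) \<Rightarrow> ('a \<Rightarrow> real) \<Rightarrow> ('b \<Rightarrow> real) \<Rightarrow> (nat \<Rightarrow> 'a \<times> 'b) \<Rightarrow> bool" where
  "pdbs F G K JX JY u \<longleftrightarrow> (\<forall>k.
     gateaux_deriv JX (fst (u k)) - partial_x K (u k)
       \<in> gateaux_deriv JX (fst (u (Suc k))) +o subdifferential F (fst (u (Suc k))) \<and>
     gateaux_deriv JY (snd (u k)) - partial_y K (u k)
       \<in> (gateaux_deriv JY (snd (u (Suc k))) - 2 *\<^sub>R partial_y K (u (Suc k)))
            +o subdifferential G (snd (u (Suc k))))"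

definition ergodic :: "(nat \<Rightarrow> 'a::real_vector) \<Rightarrow> nat \<Rightarrow> 'a" where
  "ergodic u N = (1 / real N) *\<^sub>R (\<Sum>k<N. u (Suc k))"

definition lagrangian ::
    "('a \<Rightarrow> ereal) \<Rightarrow> ('b \<Rightarrow> ereal) \<Rightarrow> ('a \<times> 'b \<Rightarrow> real) \<Rightarrow> 'a \<Rightarrow> 'b \<Rightarrow> ereal" where
  "lagrangian F G K x y = F x + ereal (K (x, y)) - G y"

text \<open>For proper \<open>F\<close> and \<open>G\<close> and \<open>u\<close> in the product of their effective domains (as is the case
  for all iterates and their averages), none of the extended-real sums and differences below
  is of the indeterminate form \<open>\<infinity> - \<infinity>\<close>, whatever \<open>v\<close> is.\<close>

definition lagrangian_gap ::
    "('a \<Rightarrow> ereal) \<Rightarrow> ('b \<Rightarrow> ereal) \<Rightarrow> ('a \<times> 'b \<Rightarrow> real) \<Rightarrow> 'a \<times> 'b \<Rightarrow> 'a \<times> 'b \<Rightarrow> ereal" where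
  "lagrangian_gap F G K u v =
     lagrangian F G K (fst u) (snd v) - lagrangian F G K (fst v) (snd u)"

definition partial_gap ::
    "('a \<Rightarrow> ereal) \<Rightarrow> ('b \<Rightarrow> ereal) \<Rightarrow> ('a \<times> 'b \<Rightarrow> real) \<Rightarrow> ('a \<times> 'b) set \<Rightarrow> 'a \<times> 'b \<Rightarrow> ereal" where
  "partial_gap F G K \<Omega> u = (SUP v\<in>\<Omega>. lagrangian_gap F G K u v)"

text \<open>Since \<open>real_of_ereal\<close> maps infinite values to 0, finiteness is required separately. The
  index 0 is excluded, as averages over no iterates have no meaning.\<close>

definition ereal_bigo :: "(nat \<Rightarrow> ereal) \<Rightarrow> (nat \<Rightarrow> real) \<Rightarrow> bool" where
  "ereal_bigo a r \<longleftrightarrow> (\<forall>N\<ge>1. \<bar>a N\<bar> \<noteq> \<infinity>) \<and> (\<lambda>N. real_of_ereal (a N)) \<in> O(r)"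

end

theory Submission
  imports Defs
begin

text \<open>Testing the two inclusions with an arbitrary point \<open>v\<close> and linearising \<open>K\<close> at the new iterate
  gives \<open>gap (u (k+1)) v \<le> \<langle>DJ\<^sup>0 (u k) - DJ\<^sup>0 (u (k+1)) | u (k+1) - v\<rangle>\<close>, and the three-point identity
  turns the right-hand side into a telescoping expression of Bregman divergences. For \<open>v = w\<close> a zero
  of the saddle map this bounds the sum of the gaps by \<open>B\<^sup>0 w (u 0)\<close>, and for other \<open>v\<close> it differs
  only by the linear term \<open>\<langle>DJ\<^sup>0 (u 0) - DJ\<^sup>0 (u N) | w - v\<rangle>\<close>. In infinite dimension \<open>J\<^sup>0\<close> may be
  unbounded on a bounded \<open>\<Omega>\<close>, so the partial gap is controlled through this linear term: the
  derivatives \<open>DJ\<^sup>0 (u N)\<close> are bounded because \<open>B\<^sup>0 w (u N)\<close> is bounded and \<open>J\<^sup>0\<close> is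
  bounded near \<open>w\<close>.\<close>

section \<open>Gateaux derivatives\<close>

lemma has_gateaux_derivative_unique:
  assumes "has_gateaux_derivative J A x" "has_gateaux_derivative J B x"
  shows "A = B"
proof (rule blinfun_eqI)
  fix h
  show "blinfun_apply A h = blinfun_apply B h"
    using assms tendsto_unique[OF trivial_limit_at] unfolding has_gateaux_derivative_def by blast
qed

lemma gateaux_deriv_eq: "has_gateaux_derivative J A x \<Longrightarrow> gateaux_deriv J x = A"
  unfolding gateaux_deriv_def by (blast intro: has_gateaux_derivative_unique)

lemma C1_fun_has_gateaux_derivative:
  "C1_fun J \<Longrightarrow> has_gateaux_derivative J (gateaux_deriv J x) x"
  unfolding C1_fun_def using gateaux_deriv_eq by metis

lemma has_gateaux_derivative_add:
  assumes "has_gateaux_derivative f A x" "has_gateaux_derivative g B x"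
  shows "has_gateaux_derivative (\<lambda>x. f x + g x) (A + B) x"
  unfolding has_gateaux_derivative_def
proof
  fix h
  have "((\<lambda>t. (f (x + t *\<^sub>R h) - f x) / t + (g (x + t *\<^sub>R h) - g x) / t)
      \<longlongrightarrow> blinfun_apply A h + blinfun_apply B h) (at 0)"
    using assms unfolding has_gateaux_derivative_def by (intro tendsto_add) auto
  then show "((\<lambda>t. (f (x + t *\<^sub>R h) + g (x + t *\<^sub>R h) - (f x + g x)) / t)
      \<longlongrightarrow> blinfun_apply (A + B) h) (at 0)"
    by (simp add: blinfun.add_left add_diff_add add_divide_distrib)
qed

lemma has_gateaux_derivative_minus:
  assumes "has_gateaux_derivative f A x"
  shows "has_gateaux_derivative (\<lambda>x. - f x) (- A) x"
  unfolding has_gateaux_derivative_def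
proof
  fix h
  have "((\<lambda>t. - ((f (x + t *\<^sub>R h) - f x) / t)) \<longlongrightarrow> - blinfun_apply A h) (at 0)"
    using assms unfolding has_gateaux_derivative_def by (intro tendsto_minus) auto
  then show "((\<lambda>t. (- f (x + t *\<^sub>R h) - - f x) / t) \<longlongrightarrow> blinfun_apply (- A) h) (at 0)"
    by (simp add: blinfun.minus_left minus_divide_left)
qed

lemma has_gateaux_derivative_diff:
  assumes "has_gateaux_derivative f A x" "has_gateaux_derivative g B x"
  shows "has_gateaux_derivative (\<lambda>x. f x - g x) (A - B) x"
  using has_gateaux_derivative_add[OF assms(1) has_gateaux_derivative_minus[OF assms(2)]] by simp

lemma has_gateaux_derivative_compose_linear:
  assumes "has_gateaux_derivative f A (blinfun_apply L x)"
  shows "has_gateaux_derivative (\<lambda>x. f (blinfun_apply L x)) (A o\<^sub>L L) x"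
  using assms unfolding has_gateaux_derivative_def
  by (simp add: blinfun.add_right blinfun.scaleR_right)

section \<open>Partial derivatives as restrictions of the full derivative\<close>

text \<open>Difference quotients of the section are those of \<open>K\<close> in the directions
  \<open>(h, 0)\<close>. Hence the partial derivative exists, and the description in
  \<open>partial_x\<close> denotes it.\<close>

lemma has_gateaux_derivative_partial_x:
  assumes "C1_fun K"
  shows "has_gateaux_derivative (\<lambda>x. K (x, snd u)) (partial_x K u) (fst u)"
    and "blinfun_apply (partial_x K u) h = blinfun_apply (gateaux_deriv K u) (h, 0)"
proof -
  define L :: "'a \<Rightarrow>\<^sub>L ('a \<times> 'b)" where "L = Blinfun (\<lambda>h. (h, 0))"
  have L: "blinfun_apply L h = (h, 0)" for h
    unfolding L_def by (subst bounded_linear_Blinfun_apply)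
      (auto intro: bounded_linear_Pair bounded_linear_ident bounded_linear_zero)
  have *: "has_gateaux_derivative (\<lambda>x. K (x, snd u)) (gateaux_deriv K u o\<^sub>L L) (fst u)"
    unfolding has_gateaux_derivative_def
  proof
    fix h
    have "((\<lambda>t. (K (u + t *\<^sub>R (h, 0)) - K u) / t) \<longlongrightarrow> blinfun_apply (gateaux_deriv K u) (h, 0)) (at 0)"
      using C1_fun_has_gateaux_derivative[OF assms, of u] unfolding has_gateaux_derivative_def by blast
    then show "((\<lambda>t. (K (fst u + t *\<^sub>R h, snd u) - K (fst u, snd u)) / t)
        \<longlongrightarrow> blinfun_apply (gateaux_deriv K u o\<^sub>L L) h) (at 0)"
      by (simp add: L plus_prod_def)
  qed
  then have eq: "partial_x K u = gateaux_deriv K u o\<^sub>L L"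
    unfolding partial_x_def by (rule gateaux_deriv_eq)
  show "has_gateaux_derivative (\<lambda>x. K (x, snd u)) (partial_x K u) (fst u)"
    using * eq by simp
  show "blinfun_apply (partial_x K u) h = blinfun_apply (gateaux_deriv K u) (h, 0)"
    by (simp add: eq L)
qed

lemma has_gateaux_derivative_partial_y:
  assumes "C1_fun K"
  shows "has_gateaux_derivative (\<lambda>y. K (fst u, y)) (partial_y K u) (snd u)"
    and "blinfun_apply (partial_y K u) h = blinfun_apply (gateaux_deriv K u) (0, h)"
proof -
  define L :: "'b \<Rightarrow>\<^sub>L ('a \<times> 'b)" where "L = Blinfun (\<lambda>h. (0, h))"
  have L: "blinfun_apply L h = (0, h)" for h
    unfolding L_def by (subst bounded_linear_Blinfun_apply)
      (auto intro: bounded_linear_Pair bounded_linear_ident bounded_linear_zero)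
  have *: "has_gateaux_derivative (\<lambda>y. K (fst u, y)) (gateaux_deriv K u o\<^sub>L L) (snd u)"
    unfolding has_gateaux_derivative_def
  proof
    fix h
    have "((\<lambda>t. (K (u + t *\<^sub>R (0, h)) - K u) / t) \<longlongrightarrow> blinfun_apply (gateaux_deriv K u) (0, h)) (at 0)"
      using C1_fun_has_gateaux_derivative[OF assms, of u] unfolding has_gateaux_derivative_def by blast
    then show "((\<lambda>t. (K (fst u, snd u + t *\<^sub>R h) - K (fst u, snd u)) / t)
        \<longlongrightarrow> blinfun_apply (gateaux_deriv K u o\<^sub>L L) h) (at 0)"
      by (simp add: L plus_prod_def)
  qed
  then have eq: "partial_y K u = gateaux_deriv K u o\<^sub>L L"
    unfolding partial_y_def by (rule gateaux_deriv_eq)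
  show "has_gateaux_derivative (\<lambda>y. K (fst u, y)) (partial_y K u) (snd u)"
    using * eq by simp
  show "blinfun_apply (partial_y K u) h = blinfun_apply (gateaux_deriv K u) (0, h)"
    by (simp add: eq L)
qed

section \<open>Tangent inequalities\<close>

text \<open>Slopes along the segment from \<open>x\<close> to \<open>z\<close> are at most
  \<open>f z - f x\<close>; let the step tend to zero from the right. Convexity is used on that
  segment only, so \<open>S\<close> may be an effective domain without interior.\<close>

lemma convex_on_gateaux_above_tangent:
  assumes "convex_on S f" "has_gateaux_derivative f A x" "x \<in> S" "z \<in> S"
  shows "f x + blinfun_apply A (z - x) \<le> f z"
proof -
  have lim: "((\<lambda>t. (f (x + t *\<^sub>R (z - x)) - f x) / t) \<longlongrightarrow> blinfun_apply A (z - x)) (at_right 0)"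
    using assms(2) unfolding has_gateaux_derivative_def
    by (blast intro: tendsto_mono[OF at_le] )
  have "eventually (\<lambda>t::real. t \<in> {0<..<1}) (at_right 0)"
    by (rule eventually_at_right_real) simp
  then have "eventually (\<lambda>t. (f (x + t *\<^sub>R (z - x)) - f x) / t \<le> f z - f x) (at_right 0)"
  proof eventually_elim
    case (elim t)
    have "f ((1 - t) *\<^sub>R x + t *\<^sub>R z) \<le> (1 - t) * f x + t * f z"
      using elim assms by (intro convex_onD) auto
    moreover have "(1 - t) *\<^sub>R x + t *\<^sub>R z = x + t *\<^sub>R (z - x)"
      by (simp add: algebra_simps)
    ultimately show ?case
      using elim by (simp add: divide_simps algebra_simps)
  qed
  from tendsto_upperbound[OF lim this] show ?thesis by simp
qed

lemma concave_on_gateaux_below_tangent: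
  assumes "concave_on S f" "has_gateaux_derivative f A x" "x \<in> S" "z \<in> S"
  shows "f z \<le> f x + blinfun_apply A (z - x)"
  using convex_on_gateaux_above_tangent[OF _ has_gateaux_derivative_minus[OF assms(2)] assms(3,4)]
    assms(1) unfolding concave_on_def by (simp add: blinfun.minus_left)

section \<open>The derivative of \<open>J0\<close>\<close>

lemma has_gateaux_derivative_J0:
  assumes "C1_fun JX" "C1_fun JY" "C1_fun K"
  shows "has_gateaux_derivative (J0 JX JY K)
    ((gateaux_deriv JX (fst u) o\<^sub>L fst_blinfun) + (gateaux_deriv JY (snd u) o\<^sub>L snd_blinfun)
      - gateaux_deriv K u) u"
proof -
  have "has_gateaux_derivative (\<lambda>u. JX (blinfun_apply fst_blinfun u))
      (gateaux_deriv JX (fst u) o\<^sub>L fst_blinfun) u"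
    "has_gateaux_derivative (\<lambda>u. JY (blinfun_apply snd_blinfun u))
      (gateaux_deriv JY (snd u) o\<^sub>L snd_blinfun) u"
    by (rule has_gateaux_derivative_compose_linear,
        simp add: C1_fun_has_gateaux_derivative assms)+
  from has_gateaux_derivative_diff[OF has_gateaux_derivative_add[OF this]
      C1_fun_has_gateaux_derivative[OF assms(3)]]
  show ?thesis
    unfolding J0_def[abs_def] by simp
qed

lemma gateaux_deriv_J0:
  assumes "C1_fun JX" "C1_fun JY" "C1_fun K"
  shows "gateaux_deriv (J0 JX JY K) u =
    (gateaux_deriv JX (fst u) o\<^sub>L fst_blinfun) + (gateaux_deriv JY (snd u) o\<^sub>L snd_blinfun)
      - gateaux_deriv K u"
  by (rule gateaux_deriv_eq[OF has_gateaux_derivative_J0[OF assms]])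

text \<open>The two components are exactly the left-hand sides of the two inclusions that define the
  iteration.\<close>

lemma gateaux_deriv_J0_apply:
  assumes "C1_fun JX" "C1_fun JY" "C1_fun K"
  shows "blinfun_apply (gateaux_deriv (J0 JX JY K) u) h =
    blinfun_apply (gateaux_deriv JX (fst u) - partial_x K u) (fst h) +
    blinfun_apply (gateaux_deriv JY (snd u) - partial_y K u) (snd h)"
proof -
  have "blinfun_apply (gateaux_deriv K u) h =
      blinfun_apply (partial_x K u) (fst h) + blinfun_apply (partial_y K u) (snd h)"
    using has_gateaux_derivative_partial_x(2)[OF assms(3)] has_gateaux_derivative_partial_y(2)[OF assms(3)]
      blinfun.add_right[of "gateaux_deriv K u" "(fst h, 0)" "(0, snd h)"] by simp
  then show ?thesis
    by (simp add: gateaux_deriv_J0[OF assms] blinfun.add_left blinfun.diff_left)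
qed

lemma C1_fun_J0:
  assumes "C1_fun JX" "C1_fun JY" "C1_fun K"
  shows "C1_fun (J0 JX JY K)"
proof -
  have "continuous_on UNIV (\<lambda>u. gateaux_deriv JX (fst u))"
    "continuous_on UNIV (\<lambda>u. gateaux_deriv JY (snd u))" "continuous_on UNIV (gateaux_deriv K)"
    using assms unfolding C1_fun_def
    by (auto intro!: continuous_on_compose2[of UNIV "gateaux_deriv JX" UNIV fst]
        continuous_on_compose2[of UNIV "gateaux_deriv JY" UNIV snd] continuous_intros)
  then have "continuous_on UNIV (gateaux_deriv (J0 JX JY K))"
    unfolding gateaux_deriv_J0[OF assms, abs_def] comp_def
    by (intro continuous_intros bounded_linear.continuous_on[OF
          bounded_bilinear.bounded_linear_left[OF bounded_bilinear_blinfun_compose]])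
  then show ?thesis
    using has_gateaux_derivative_J0[OF assms] unfolding C1_fun_def by blast
qed


section \<open>Bregman divergences\<close>

text \<open>All values of \<open>J\<close> cancel, leaving only derivative terms. For consecutive
  iterates \<open>u\<close> and \<open>u'\<close> the first two divergences telescope.\<close>

lemma bregman_three_point:
  "bregman J v u - bregman J v u' - bregman J u' u =
    blinfun_apply (gateaux_deriv J u - gateaux_deriv J u') (u' - v)"
  by (simp add: bregman_def blinfun.diff_left blinfun.diff_right)

text \<open>An upper bound suffices because the ball is symmetric: applying it to \<open>h\<close>
  and \<open>- h\<close> bounds the absolute value.\<close>

lemma norm_blinfun_le_of_upper_bound_on_ball:
  fixes A :: "'a::real_normed_vector \<Rightarrow>\<^sub>L real"
  assumes "0 < r" and "\<And>h. norm h \<le> r \<Longrightarrow> blinfun_apply A h \<le> c"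
  shows "norm A \<le> c / r"
proof (rule norm_blinfun_bound)
  show "0 \<le> c / r"
    using assms(1) assms(2)[of 0] by simp
  fix x
  show "norm (blinfun_apply A x) \<le> c / r * norm x"
  proof (cases "x = 0")
    case False
    \<comment> \<open>The factor that rescales \<open>x\<close> to norm \<open>r\<close>.\<close>
    define s where "s = r / norm x"
    have s: "0 < s" using False \<open>0 < r\<close> by (simp add: s_def)
    have "blinfun_apply A (s *\<^sub>R x) \<le> c" "blinfun_apply A ((- s) *\<^sub>R x) \<le> c"
      using False \<open>0 < r\<close> by (auto intro!: assms(2) simp: s_def)
    then have "s * \<bar>blinfun_apply A x\<bar> \<le> c"
      by (cases "0 \<le> blinfun_apply A x") (auto simp: blinfun.scaleR_right blinfun.minus_right)
    then show ?thesis
      using False \<open>0 < r\<close> by (simp add: s_def field_simps)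
  qed simp
qed

text \<open>Nonnegativity of the divergence in both arguments makes \<open>J\<close> bounded near \<open>w\<close>, and a bound on
  \<open>B\<^sub>J(w, z)\<close> then transfers to the derivative at \<open>z\<close>.\<close>

lemma gateaux_deriv_bounded_on_bregman_sublevel:
  assumes "C1_fun J" and "semi_elliptic (bregman J)"
  shows "bounded (gateaux_deriv J ` {z. bregman J w z \<le> c})"
proof -
  have "isCont (gateaux_deriv J) w"
    using assms(1) unfolding C1_fun_def by (simp add: continuous_on_eq_continuous_at)
  then obtain d where d: "0 < d" "\<And>z. dist z w < d \<Longrightarrow> dist (gateaux_deriv J z) (gateaux_deriv J w) < 1"
    unfolding continuous_at_eps_delta by (metis zero_less_one)
  \<comment> \<open>Halving \<open>d\<close> puts the closed ball of radius \<open>r\<close> inside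
    the open ball of radius \<open>d\<close>.\<close>
  define r where "r = d / 2"
  define M where "M = norm (gateaux_deriv J w) + 1"
  have r: "0 < r" using d(1) by (simp add: r_def)
  have M: "norm (gateaux_deriv J (w + h)) \<le> M" if "norm h \<le> r" for h
  proof -
    have "dist (gateaux_deriv J (w + h)) (gateaux_deriv J w) < 1"
      using that d(1) by (intro d(2)) (simp add: dist_norm r_def)
    then show ?thesis
      using norm_triangle_sub[of "gateaux_deriv J (w + h)" "gateaux_deriv J w"]
      unfolding M_def dist_norm by linarith
  qed
  have "norm (gateaux_deriv J z) \<le> (M * r + c) / r" if z: "bregman J w z \<le> c" for z
  proof (rule norm_blinfun_le_of_upper_bound_on_ball[OF r])
    fix h :: 'a assume h: "norm h \<le> r"
    \<comment> \<open>The first inequality bounds the derivative at \<open>z\<close> applied to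
      \<open>h\<close> by \<open>J (w + h) - J w + bregman J w z\<close>; the second bounds the
      increment \<open>J (w + h) - J w\<close> by the derivative at \<open>w + h\<close>, which is
      controlled near \<open>w\<close>.\<close>
    have "0 \<le> bregman J (w + h) z" "0 \<le> bregman J w (w + h)"
      using assms(2) unfolding semi_elliptic_def by auto
    then have "blinfun_apply (gateaux_deriv J z) h \<le> c + blinfun_apply (gateaux_deriv J (w + h)) h"
      using z by (simp add: bregman_def blinfun.add_right blinfun.diff_right blinfun.minus_right)
    also have "blinfun_apply (gateaux_deriv J (w + h)) h \<le> norm (gateaux_deriv J (w + h)) * norm h"
      using norm_blinfun[of "gateaux_deriv J (w + h)" h] by simp
    also have "\<dots> \<le> M * r"
      using M[OF h] h norm_ge_zero[of "gateaux_deriv J (w + h)"] by (intro mult_mono) (auto simp: M_def)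
    finally show "blinfun_apply (gateaux_deriv J z) h \<le> M * r + c" by simp
  qed
  then show ?thesis unfolding bounded_iff by blast
qed


section \<open>Extended-real-valued functions\<close>

lemma proper_fun_finite:
  assumes "proper_fun f" "x \<in> effective_domain f"
  shows "f x = ereal (real_of_ereal (f x))"
  using assms unfolding proper_fun_def effective_domain_def by (cases "f x") auto

lemma subdifferential_effective_domain:
  "p \<in> subdifferential f x \<Longrightarrow> x \<in> effective_domain f"
  unfolding subdifferential_def effective_domain_def by auto

lemma subdifferential_real_of_ereal_le:
  assumes "proper_fun f" "p \<in> subdifferential f x" "z \<in> effective_domain f"
  shows "real_of_ereal (f x) + blinfun_apply p (z - x) \<le> real_of_ereal (f z)"
proof -
  have "f x + ereal (blinfun_apply p (z - x)) \<le> f z"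
    using assms(2) unfolding subdifferential_def by blast
  then show ?thesis
    using proper_fun_finite[OF assms(1) assms(3)]
      proper_fun_finite[OF assms(1) subdifferential_effective_domain[OF assms(2)]]
    by (metis ereal_less_eq(3) plus_ereal.simps(1))
qed

text \<open>Over the effective domain the graph of a proper function lies in its real epigraph, so
  convexity of the epigraph applies to pairs of graph points.\<close>

lemma convex_ereal_fun_imp_convex_on:
  assumes "convex_ereal_fun f" "proper_fun f"
  shows "convex_on (effective_domain f) (\<lambda>x. real_of_ereal (f x))"
proof -
  have *: "f (s *\<^sub>R x + t *\<^sub>R y) \<le> ereal (s * real_of_ereal (f x) + t * real_of_ereal (f y))"
    if "x \<in> effective_domain f" "y \<in> effective_domain f" "0 \<le> s" "0 \<le> t" "s + t = 1" for x y s t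
  proof -
    have "(z, real_of_ereal (f z)) \<in> {(x, t::real). f x \<le> ereal t}" if "z \<in> effective_domain f" for z
      using proper_fun_finite[OF assms(2) that] by simp
    from convexD[OF assms(1)[unfolded convex_ereal_fun_def] this[OF that(1)] this[OF that(2)] that(3-5)]
    show ?thesis by simp
  qed
  \<comment> \<open>The upper bound in \<open>*\<close> is a real number, so convex combinations
    stay in the domain.\<close>
  have dom: "convex (effective_domain f)"
    unfolding convex_def using * by (fastforce simp: effective_domain_def intro: le_less_trans)
  show ?thesis
    unfolding convex_on_def
  proof (intro conjI ballI allI impI dom)
    fix x y and s t :: real
    assume A: "x \<in> effective_domain f" "y \<in> effective_domain f" "0 \<le> s" "0 \<le> t" "s + t = 1"
    then have "s *\<^sub>R x + t *\<^sub>R y \<in> effective_domain f"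
      using dom by (auto intro: convexD)
    from proper_fun_finite[OF assms(2) this] *[OF A]
    show "real_of_ereal (f (s *\<^sub>R x + t *\<^sub>R y)) \<le> s * real_of_ereal (f x) + t * real_of_ereal (f y)"
      by (metis ereal_less_eq(3))
  qed
qed

section \<open>Averages and rates of order 1/N\<close>

lemma convex_on_average:
  assumes "convex_on S f" "1 \<le> N" "\<And>k. k < N \<Longrightarrow> x k \<in> S"
  shows "f ((1 / real N) *\<^sub>R (\<Sum>k<N. x k)) \<le> (1 / real N) * (\<Sum>k<N. f (x k))"
proof -
  have "f (\<Sum>k<N. (1 / real N) *\<^sub>R x k) \<le> (\<Sum>k<N. (1 / real N) * f (x k))"
    using assms by (intro convex_on_sum) (auto simp: lessThan_empty_iff)
  then show ?thesis by (simp add: scaleR_sum_right sum_distrib_left)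
qed

lemma convex_average:
  assumes "convex S" "1 \<le> N" "\<And>k. k < N \<Longrightarrow> x k \<in> S"
  shows "(1 / real N) *\<^sub>R (\<Sum>k<N. x k) \<in> S"
  unfolding scaleR_sum_right using assms by (intro convex_sum) auto

text \<open>Common shape of all three claims: the two-sided bound squeezes the limit, forces
  finiteness and is itself the rate. Index 0 is left out because \<open>ergodic u 0\<close> is the
  zero vector, which may lie outside the domains.\<close>

lemma nonneg_inverse_bound_rate:
  assumes "\<And>N. 1 \<le> N \<Longrightarrow> 0 \<le> a N" "\<And>N. 1 \<le> N \<Longrightarrow> a N \<le> ereal (1 / real N * c)"
  shows "(\<forall>N\<ge>1. 0 \<le> a N) \<and> a \<longlonglongrightarrow> 0 \<and> ereal_bigo a (\<lambda>N. 1 / real N)"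
proof (intro conjI)
  show "\<forall>N\<ge>1. 0 \<le> a N" using assms(1) by blast
  have "(\<lambda>N. 1 / real N * c) \<longlonglongrightarrow> 0"
    by (intro tendsto_mult_left_zero lim_1_over_n)
  then have lim: "(\<lambda>N. ereal (1 / real N * c)) \<longlonglongrightarrow> 0"
    by (simp add: zero_ereal_def)
  show "a \<longlonglongrightarrow> 0"
    by (rule tendsto_sandwich[OF _ _ tendsto_const lim])
      (use assms in \<open>auto simp: eventually_sequentially intro!: exI[of _ 1]\<close>)
  have fin: "\<bar>a N\<bar> \<noteq> \<infinity>" if "1 \<le> N" for N
    using assms[OF that] by (cases "a N") auto
  have "norm (real_of_ereal (a N)) \<le> c * norm (1 / real N)" if "1 \<le> N" for N
    using assms[OF that] fin[OF that] by (cases "a N") (auto simp: mult.commute)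
  then show "ereal_bigo a (\<lambda>N. 1 / real N)"
    unfolding ereal_bigo_def using fin
    by (auto intro!: bigoI[of _ c] simp: eventually_sequentially intro!: exI[of _ 1])
qed


section \<open>Gap estimates\<close>

locale saddle_problem =
  fixes F :: "'a::real_normed_vector \<Rightarrow> ereal" and G :: "'b::real_normed_vector \<Rightarrow> ereal"
    and K :: "'a \<times> 'b \<Rightarrow> real"
  assumes convex_F: "convex_ereal_fun F" and proper_F: "proper_fun F"
    and convex_G: "convex_ereal_fun G" and proper_G: "proper_fun G"
    and C1_K: "C1_fun K"
    and convex_concave: "convex_concave_within (effective_domain F) (effective_domain G) K"
begin

definition dom :: "('a \<times> 'b) set" where
  "dom = effective_domain F \<times> effective_domain G"

text \<open>A real-valued form of the Lagrangian gap, faithful on \<open>dom\<close>, where linear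
  arithmetic applies. It is antisymmetric in its arguments.\<close>

definition gap :: "'a \<times> 'b \<Rightarrow> 'a \<times> 'b \<Rightarrow> real" where
  "gap u v = real_of_ereal (F (fst u)) + K (fst u, snd v) - real_of_ereal (G (snd v))
     - real_of_ereal (F (fst v)) - K (fst v, snd u) + real_of_ereal (G (snd u))"

lemma convex_dom: "convex dom"
  unfolding dom_def
  using convex_ereal_fun_imp_convex_on[OF convex_F proper_F]
    convex_ereal_fun_imp_convex_on[OF convex_G proper_G]
  by (auto intro: convex_Times convex_on_imp_convex)

lemma lagrangian_gap_eq_gap:
  assumes "u \<in> dom" "v \<in> dom"
  shows "lagrangian_gap F G K u v = ereal (gap u v)"
proof -
  obtain a b c d where "F (fst u) = ereal a" "F (fst v) = ereal b"
    "G (snd u) = ereal c" "G (snd v) = ereal d"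
    using assms proper_fun_finite[OF proper_F] proper_fun_finite[OF proper_G]
    unfolding dom_def by (metis mem_Times_iff)
  then show ?thesis
    by (simp add: lagrangian_gap_def lagrangian_def gap_def)
qed

text \<open>Either the first Lagrangian is \<open>- \<infinity>\<close> or the second is
  \<open>\<infinity>\<close>. Points of \<Omega> outside \<open>dom\<close> therefore never raise
  the supremum in the partial gap.\<close>

lemma lagrangian_gap_eq_MInfty:
  assumes "u \<in> dom" "v \<notin> dom"
  shows "lagrangian_gap F G K u v = - \<infinity>"
proof -
  obtain a c where ac: "F (fst u) = ereal a" "G (snd u) = ereal c"
    using assms proper_fun_finite[OF proper_F] proper_fun_finite[OF proper_G]
    unfolding dom_def by (metis mem_Times_iff)
  have "F (fst v) \<noteq> - \<infinity>" "G (snd v) \<noteq> - \<infinity>" "F (fst v) = \<infinity> \<or> G (snd v) = \<infinity>"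
    using assms(2) proper_F proper_G
    by (auto simp: dom_def mem_Times_iff effective_domain_def proper_fun_def)
  then show ?thesis
    by (cases "F (fst v)"; cases "G (snd v)") (auto simp: ac lagrangian_gap_def lagrangian_def)
qed

section \<open>Bounding the gap by subgradients\<close>

lemma K_above_tangent:
  assumes "u \<in> dom" "x \<in> effective_domain F"
  shows "K u + blinfun_apply (partial_x K u) (x - fst u) \<le> K (x, snd u)"
proof -
  have "convex_on (effective_domain F) (\<lambda>x. K (x, snd u))"
    using convex_concave assms(1) by (auto simp: convex_concave_within_def dom_def)
  from convex_on_gateaux_above_tangent[OF this has_gateaux_derivative_partial_x(1)[OF C1_K] _ assms(2)]
  show ?thesis using assms(1) by (auto simp: dom_def)
qed

lemma K_below_tangent:
  assumes "u \<in> dom" "y \<in> effective_domain G"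
  shows "K (fst u, y) \<le> K u + blinfun_apply (partial_y K u) (y - snd u)"
proof -
  have "concave_on (effective_domain G) (\<lambda>y. K (fst u, y))"
    using convex_concave assms(1) by (auto simp: convex_concave_within_def dom_def)
  from concave_on_gateaux_below_tangent[OF this has_gateaux_derivative_partial_y(1)[OF C1_K] _ assms(2)]
  show ?thesis using assms(1) by (auto simp: dom_def)
qed

lemma subgradients_imp_in_dom:
  assumes "p \<in> subdifferential F (fst u)" "q \<in> subdifferential G (snd u)"
  shows "u \<in> dom"
  using assms by (auto simp: dom_def mem_Times_iff intro: subdifferential_effective_domain)

text \<open>Add the subgradient inequalities of \<open>F\<close> and \<open>G\<close> to the tangent
  inequalities of \<open>K\<close> at \<open>u\<close> in each variable; the value
  \<open>K u\<close> cancels.\<close>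

lemma gap_le_subgradients:
  assumes p: "p \<in> subdifferential F (fst u)" and q: "q \<in> subdifferential G (snd u)" and v: "v \<in> dom"
  shows "gap u v \<le> blinfun_apply (p + partial_x K u) (fst u - fst v)
    + blinfun_apply (q - partial_y K u) (snd u - snd v)"
proof -
  have v': "fst v \<in> effective_domain F" "snd v \<in> effective_domain G"
    using v by (auto simp: dom_def)
  note u = subgradients_imp_in_dom[OF p q]
  show ?thesis
    using subdifferential_real_of_ereal_le[OF proper_F p v'(1)]
      subdifferential_real_of_ereal_le[OF proper_G q v'(2)]
      K_above_tangent[OF u v'(1)] K_below_tangent[OF u v'(2)]
    by (simp add: gap_def blinfun.add_left blinfun.diff_left blinfun.diff_right)
qed

lemma saddle_zeros_subgradients:
  assumes "w \<in> saddle_zeros F G K"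
  shows "- partial_x K w \<in> subdifferential F (fst w)" "partial_y K w \<in> subdifferential G (snd w)"
proof -
  have "0 \<in> partial_x K w +o subdifferential F (fst w)"
    "0 \<in> (- partial_y K w) +o subdifferential G (snd w)"
    using assms by (auto simp: saddle_zeros_def saddle_map_def zero_prod_def)
  then show "- partial_x K w \<in> subdifferential F (fst w)" "partial_y K w \<in> subdifferential G (snd w)"
    by (auto simp: elt_set_plus_def eq_neg_iff_add_eq_0 minus_unique)
qed

lemma saddle_zeros_in_dom: "w \<in> saddle_zeros F G K \<Longrightarrow> w \<in> dom"
  by (rule subgradients_imp_in_dom[OF saddle_zeros_subgradients])

text \<open>With the subgradients supplied by a zero \<open>w\<close>, both linear terms in the
  bound on \<open>gap w u\<close> vanish; antisymmetry of the gap does the rest.\<close>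

lemma gap_nonneg:
  assumes w: "w \<in> saddle_zeros F G K" and u: "u \<in> dom"
  shows "0 \<le> gap u w"
proof -
  have "gap w u \<le> 0"
    using gap_le_subgradients[OF saddle_zeros_subgradients[OF w] u] by simp
  then show ?thesis by (simp add: gap_def)
qed

text \<open>For fixed \<open>v\<close> the gap is a convex function of \<open>x\<close> plus a
  convex function of \<open>y\<close> plus a constant, so Jensen's inequality applies to each
  part.\<close>

lemma gap_ergodic_le:
  assumes "1 \<le> N" "\<And>k. u (Suc k) \<in> dom" "v \<in> dom"
  shows "gap (ergodic u N) v \<le> 1 / real N * (\<Sum>k<N. gap (u (Suc k)) v)"
proof -
  let ?avg = "\<lambda>x. (1 / real N) *\<^sub>R (\<Sum>k<N. x k)"
  let ?f = "\<lambda>x. real_of_ereal (F x) + K (x, snd v)"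
  let ?g = "\<lambda>y. real_of_ereal (G y) - K (fst v, y)"
  have f: "convex_on (effective_domain F) ?f"
    using convex_concave assms(3)
    by (intro convex_on_add convex_ereal_fun_imp_convex_on convex_F proper_F)
      (auto simp: convex_concave_within_def dom_def)
  have "convex_on (effective_domain G) (\<lambda>y. real_of_ereal (G y) + - K (fst v, y))"
    using convex_concave assms(3)
    by (intro convex_on_add convex_ereal_fun_imp_convex_on convex_G proper_G)
      (auto simp: convex_concave_within_def dom_def concave_on_def)
  then have g: "convex_on (effective_domain G) ?g" by simp
  have eq: "fst (ergodic u N) = ?avg (\<lambda>k. fst (u (Suc k)))"
    "snd (ergodic u N) = ?avg (\<lambda>k. snd (u (Suc k)))"
    by (simp_all add: ergodic_def fst_sum snd_sum)
  have "gap (ergodic u N) v = ?f (fst (ergodic u N)) + ?g (snd (ergodic u N))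
      - (real_of_ereal (F (fst v)) + real_of_ereal (G (snd v)))"
    by (simp add: gap_def)
  also have "\<dots> \<le> 1 / real N * (\<Sum>k<N. ?f (fst (u (Suc k)))) + 1 / real N * (\<Sum>k<N. ?g (snd (u (Suc k))))
      - (real_of_ereal (F (fst v)) + real_of_ereal (G (snd v)))"
    unfolding eq using assms(1,2)
    by (intro diff_right_mono add_mono convex_on_average[OF f] convex_on_average[OF g])
      (auto simp: dom_def mem_Times_iff)
  also have "\<dots> = 1 / real N * (\<Sum>k<N. gap (u (Suc k)) v)"
    using assms(1) by (simp add: gap_def sum.distrib sum_subtractf field_simps)
  finally show ?thesis .
qed

end


section \<open>Telescoping along the iterates\<close>

locale pdbs_iterates = saddle_problem F G K
  for F :: "'a::real_normed_vector \<Rightarrow> ereal" and G :: "'b::real_normed_vector \<Rightarrow> ereal"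
    and K :: "'a \<times> 'b \<Rightarrow> real" +
  fixes JX :: "'a \<Rightarrow> real" and JY :: "'b \<Rightarrow> real" and u :: "nat \<Rightarrow> 'a \<times> 'b"
  assumes C1_JX: "C1_fun JX" and C1_JY: "C1_fun JY"
    and semi_elliptic_J0: "semi_elliptic (bregman (J0 JX JY K))"
    and iterates: "pdbs F G K JX JY u"
begin

abbreviation J :: "'a \<times> 'b \<Rightarrow> real" where
  "J \<equiv> J0 JX JY K"

lemma bregman_nonneg: "0 \<le> bregman J v z"
  using semi_elliptic_J0 unfolding semi_elliptic_def by blast

lemma iterates_subgradients:
  "gateaux_deriv JX (fst (u k)) - partial_x K (u k) - gateaux_deriv JX (fst (u (Suc k)))
    \<in> subdifferential F (fst (u (Suc k)))" (is ?F)
  "gateaux_deriv JY (snd (u k)) - partial_y K (u k) - gateaux_deriv JY (snd (u (Suc k)))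
    + 2 *\<^sub>R partial_y K (u (Suc k)) \<in> subdifferential G (snd (u (Suc k)))" (is ?G)
proof -
  obtain p q where "p \<in> subdifferential F (fst (u (Suc k)))" "q \<in> subdifferential G (snd (u (Suc k)))"
    "gateaux_deriv JX (fst (u k)) - partial_x K (u k) = gateaux_deriv JX (fst (u (Suc k))) + p"
    "gateaux_deriv JY (snd (u k)) - partial_y K (u k)
      = gateaux_deriv JY (snd (u (Suc k))) - 2 *\<^sub>R partial_y K (u (Suc k)) + q"
    using iterates unfolding pdbs_def elt_set_plus_def by blast
  then show ?F ?G by simp_all
qed

lemma iterates_in_dom: "u (Suc k) \<in> dom"
  by (rule subgradients_imp_in_dom[OF iterates_subgradients])

lemma ergodic_in_dom: "1 \<le> N \<Longrightarrow> ergodic u N \<in> dom"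
  unfolding ergodic_def by (rule convex_average[OF convex_dom _ iterates_in_dom])

text \<open>The factor 2 in the second inclusion matters here: subtracting
  \<open>partial_y K (u (Suc k))\<close> from the subgradient of \<open>G\<close> leaves one copy,
  so both components become differences of derivatives of \<open>J\<close>.\<close>

lemma gap_step:
  assumes "v \<in> dom"
  shows "gap (u (Suc k)) v \<le>
    blinfun_apply (gateaux_deriv J (u k) - gateaux_deriv J (u (Suc k))) (u (Suc k) - v)"
  using gap_le_subgradients[OF iterates_subgradients[of k] assms]
  by (simp add: gateaux_deriv_J0_apply[OF C1_JX C1_JY C1_K] blinfun.diff_left blinfun.add_left
      blinfun.scaleR_left)

text \<open>In the three-point identity \<open>bregman J (u (Suc k)) (u k)\<close> is dropped by
  semi-ellipticity, and the rest telescopes. The last divergence is kept: it yields monotonicity at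
  zeros and the comparison of different \<open>v\<close>.\<close>

lemma sum_gap_le:
  assumes "v \<in> dom"
  shows "(\<Sum>k<N. gap (u (Suc k)) v) \<le> bregman J v (u 0) - bregman J v (u N)"
proof -
  have "gap (u (Suc k)) v \<le> bregman J v (u k) - bregman J v (u (Suc k))" for k
    using gap_step[OF assms, of k] bregman_three_point[of J v "u k" "u (Suc k)"]
      bregman_nonneg[of "u (Suc k)" "u k"] by linarith
  then have "(\<Sum>k<N. gap (u (Suc k)) v) \<le> (\<Sum>k<N. bregman J v (u k) - bregman J v (u (Suc k)))"
    by (rule sum_mono)
  also have "\<dots> = bregman J v (u 0) - bregman J v (u N)"
    by (rule sum_lessThan_telescope')
  finally show ?thesis .
qed

lemma sum_gap_zero_le:
  assumes "w \<in> saddle_zeros F G K"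
  shows "(\<Sum>k<N. gap (u (Suc k)) w) \<le> bregman J w (u 0)"
  using sum_gap_le[OF saddle_zeros_in_dom[OF assms], of N] bregman_nonneg[of w "u N"] by linarith

text \<open>Gaps against a zero are nonnegative, hence so is the telescoped bound. All iterates thus
  stay in one Bregman sublevel set of \<open>w\<close>.\<close>

lemma bregman_zero_decreasing:
  assumes "w \<in> saddle_zeros F G K"
  shows "bregman J w (u N) \<le> bregman J w (u 0)"
  using sum_gap_le[OF saddle_zeros_in_dom[OF assms], of N]
    sum_nonneg[of "{..<N}" "\<lambda>k. gap (u (Suc k)) w"] gap_nonneg[OF assms iterates_in_dom] by auto

lemma sum_gap_bounded:
  assumes "w \<in> saddle_zeros F G K" "bounded \<Omega>"
  obtains c where "\<And>v N. v \<in> \<Omega> \<Longrightarrow> v \<in> dom \<Longrightarrow> (\<Sum>k<N. gap (u (Suc k)) v) \<le> c"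
proof -
  have "bounded (gateaux_deriv J ` {z. bregman J w z \<le> bregman J w (u 0)})"
    by (rule gateaux_deriv_bounded_on_bregman_sublevel[OF C1_fun_J0[OF C1_JX C1_JY C1_K] semi_elliptic_J0])
  then obtain M where M: "\<And>N. norm (gateaux_deriv J (u N)) \<le> M"
    unfolding bounded_iff using bregman_zero_decreasing[OF assms(1)] by blast
  obtain R where R: "\<And>v. v \<in> \<Omega> \<Longrightarrow> norm v \<le> R"
    using assms(2) unfolding bounded_iff by blast
  show thesis
  proof (rule that)
    fix v N assume v: "v \<in> \<Omega>" "v \<in> dom"
    let ?A = "gateaux_deriv J (u 0) - gateaux_deriv J (u N)"
    have "(\<Sum>k<N. gap (u (Suc k)) v) \<le> bregman J v (u 0) - bregman J v (u N)"
      by (rule sum_gap_le[OF v(2)])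
    \<comment> \<open>\<open>J v\<close> cancels in the difference, which is thus affine in
      \<open>v\<close>; replacing \<open>v\<close> by \<open>w\<close> costs only a linear
      term.\<close>
    also have "\<dots> = bregman J w (u 0) - bregman J w (u N) + blinfun_apply ?A (w - v)"
      by (simp add: bregman_def blinfun.diff_left blinfun.diff_right)
    also have "\<dots> \<le> bregman J w (u 0) + blinfun_apply ?A (w - v)"
      using bregman_nonneg[of w "u N"] by simp
    also have "blinfun_apply ?A (w - v) \<le> norm ?A * norm (w - v)"
      using norm_blinfun[of ?A "w - v"] by simp
    \<comment> \<open>One \<open>M\<close> for each of the two derivatives in
      \<open>?A\<close>.\<close>
    also have "\<dots> \<le> (M + M) * (norm w + R)"
      using norm_triangle_le_diff[OF add_mono[OF M[of 0] M[of N]]]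
        norm_triangle_le_diff[OF add_mono[OF order_refl R[OF v(1)]]]
        order_trans[OF norm_ge_zero M[of 0]]
      by (intro mult_mono) auto
    finally show "(\<Sum>k<N. gap (u (Suc k)) v) \<le> bregman J w (u 0) + (M + M) * (norm w + R)" by simp
  qed
qed

section \<open>The three convergence rates\<close>

lemma averaged_gap_rate:
  assumes w: "w \<in> saddle_zeros F G K"
  defines "a \<equiv> \<lambda>N. ereal (1 / real N) * (\<Sum>k<N. lagrangian_gap F G K (u (Suc k)) w)"
  shows "(\<forall>N\<ge>1. 0 \<le> a N) \<and> a \<longlonglongrightarrow> 0 \<and> ereal_bigo a (\<lambda>N. 1 / real N)"
proof (rule nonneg_inverse_bound_rate[where c = "bregman J w (u 0)"])
  fix N :: nat
  have a: "a N = ereal (1 / real N * (\<Sum>k<N. gap (u (Suc k)) w))"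
    unfolding a_def by (simp add: lagrangian_gap_eq_gap[OF iterates_in_dom saddle_zeros_in_dom[OF w]])
  show "0 \<le> a N"
    using gap_nonneg[OF w iterates_in_dom] by (simp add: a sum_nonneg)
  show "a N \<le> ereal (1 / real N * bregman J w (u 0))"
    unfolding a ereal_less_eq by (intro mult_left_mono sum_gap_zero_le[OF w]) simp
qed

text \<open>The bound on the sum is required only for \<open>v\<close> in \<open>dom\<close>;
  elsewhere the gap is \<open>- \<infinity>\<close> and any \<open>c\<close> works.\<close>

lemma lagrangian_gap_ergodic_le:
  assumes "1 \<le> N" "v \<in> dom \<Longrightarrow> (\<Sum>k<N. gap (u (Suc k)) v) \<le> c"
  shows "lagrangian_gap F G K (ergodic u N) v \<le> ereal (1 / real N * c)"
proof (cases "v \<in> dom")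
  case True
  have "gap (ergodic u N) v \<le> 1 / real N * (\<Sum>k<N. gap (u (Suc k)) v)"
    by (rule gap_ergodic_le) (use assms(1) iterates_in_dom True in auto)
  also have "\<dots> \<le> 1 / real N * c"
    using assms(2)[OF True] by (intro mult_left_mono) auto
  finally show ?thesis
    by (simp add: lagrangian_gap_eq_gap[OF ergodic_in_dom[OF assms(1)] True])
qed (simp add: lagrangian_gap_eq_MInfty[OF ergodic_in_dom[OF assms(1)]])

lemma lagrangian_gap_ergodic_nonneg:
  assumes "w \<in> saddle_zeros F G K" "1 \<le> N"
  shows "0 \<le> lagrangian_gap F G K (ergodic u N) w"
  using gap_nonneg[OF assms(1) ergodic_in_dom[OF assms(2)]]
  by (simp add: lagrangian_gap_eq_gap[OF ergodic_in_dom[OF assms(2)] saddle_zeros_in_dom[OF assms(1)]])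

lemma ergodic_gap_rate:
  assumes w: "w \<in> saddle_zeros F G K"
  defines "a \<equiv> \<lambda>N. lagrangian_gap F G K (ergodic u N) w"
  shows "(\<forall>N\<ge>1. 0 \<le> a N) \<and> a \<longlonglongrightarrow> 0 \<and> ereal_bigo a (\<lambda>N. 1 / real N)"
  unfolding a_def
  by (rule nonneg_inverse_bound_rate[OF lagrangian_gap_ergodic_nonneg[OF w]
        lagrangian_gap_ergodic_le[OF _ sum_gap_zero_le[OF w]]])

lemma ergodic_partial_gap_rate:
  assumes "bounded \<Omega>" "\<Omega> \<inter> saddle_zeros F G K \<noteq> {}"
  defines "a \<equiv> \<lambda>N. partial_gap F G K \<Omega> (ergodic u N)"
  shows "(\<forall>N\<ge>1. 0 \<le> a N) \<and> a \<longlonglongrightarrow> 0 \<and> ereal_bigo a (\<lambda>N. 1 / real N)"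
proof -
  obtain w where w: "w \<in> \<Omega>" "w \<in> saddle_zeros F G K"
    using assms(2) by blast
  \<comment> \<open>\<open>c\<close> is uniform in both \<open>v\<close> and \<open>N\<close>, so it
    survives the supremum and still gives a rate.\<close>
  obtain c where c: "\<And>v N. v \<in> \<Omega> \<Longrightarrow> v \<in> dom \<Longrightarrow> (\<Sum>k<N. gap (u (Suc k)) v) \<le> c"
    using sum_gap_bounded[OF w(2) assms(1)] by metis
  show ?thesis
    unfolding a_def partial_gap_def
  proof (rule nonneg_inverse_bound_rate)
    fix N :: nat assume N: "1 \<le> N"
    \<comment> \<open>The zero \<open>w\<close> in \<Omega> already contributes a nonnegative
      term.\<close>
    show "0 \<le> (SUP v\<in>\<Omega>. lagrangian_gap F G K (ergodic u N) v)"
      using w N by (blast intro: SUP_upper2 lagrangian_gap_ergodic_nonneg)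
    show "(SUP v\<in>\<Omega>. lagrangian_gap F G K (ergodic u N) v) \<le> ereal (1 / real N * c)"
      by (intro SUP_least lagrangian_gap_ergodic_le N c)
  qed
qed

end

theorem theorem5:
  fixes F :: "'a::banach \<Rightarrow> ereal" and G :: "'b::banach \<Rightarrow> ereal"
    and K :: "'a \<times> 'b \<Rightarrow> real" and JX :: "'a \<Rightarrow> real" and JY :: "'b \<Rightarrow> real"
    and u :: "nat \<Rightarrow> 'a \<times> 'b"
  assumes "convex_ereal_fun F" and "proper_fun F" and "lower_semicontinuous F"
    and "convex_ereal_fun G" and "proper_fun G" and "lower_semicontinuous G"
    and "C1_fun K" and "convex_concave_within (effective_domain F) (effective_domain G) K"
    and "C1_fun JX" and "convex_on UNIV JX"
    and "C1_fun JY" and "convex_on UNIV JY"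
    and "semi_elliptic (bregman (J0 JX JY K))"
    and "pdbs F G K JX JY u"
  shows
    "(\<forall>w \<in> saddle_zeros F G K.
        let a = (\<lambda>N. ereal (1 / real N) * (\<Sum>k<N. lagrangian_gap F G K (u (Suc k)) w))
        in (\<forall>N\<ge>1. 0 \<le> a N) \<and> a \<longlonglongrightarrow> 0 \<and> ereal_bigo a (\<lambda>N. 1 / real N)) \<and>
     (\<forall>w \<in> saddle_zeros F G K.
        let a = (\<lambda>N. lagrangian_gap F G K (ergodic u N) w)
        in (\<forall>N\<ge>1. 0 \<le> a N) \<and> a \<longlonglongrightarrow> 0 \<and> ereal_bigo a (\<lambda>N. 1 / real N)) \<and>
     (\<forall>\<Omega>. bounded \<Omega> \<and> \<Omega> \<inter> saddle_zeros F G K \<noteq> {} \<longrightarrow>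
        (let a = (\<lambda>N. partial_gap F G K \<Omega> (ergodic u N))
         in (\<forall>N\<ge>1. 0 \<le> a N) \<and> a \<longlonglongrightarrow> 0 \<and> ereal_bigo a (\<lambda>N. 1 / real N)))"
proof -
  interpret pdbs_iterates F G K JX JY u
    using assms by unfold_locales
  show ?thesis
    unfolding Let_def
    by (rule conjI[OF ballI conjI[OF ballI allI[OF impI]]])
      (erule averaged_gap_rate ergodic_gap_rate | erule conjE, erule (1) ergodic_partial_gap_rate)+
qed

end
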